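(* Let $\lambda \geq n \geq 1$ be natural numbers, and let $g(n,\lambda)$ be the chromatic polynomial, evaluated at $\lambda$, of $G(n)$, the line graph of the complete bipartite graph $K_{3,n}$. Then $$g(n,\lambda)= \frac{\lambda!}{(\lambda-n)!}\sum_{l=0}^{n}(-1)^{l}\binom{n}{l} \sum_{t_{1}=0}^{b}\;\sum_{t_{2}=0}^{l-t_{1}} A(\lambda, k, l, t_{1}, t_{2})\,\bigl(B(\lambda, k, l, t_{1})\bigr)^{2},$$ where, for each $l$, $k = n - l$, $b=\min\{k,l\}$, and $$A(\lambda, k, l, t_{1}, t_{2}) = \binom{k}{t_{1}}\binom{l}{t_{2}}\binom{\lambda - n}{l - t_{1} - t_{2}}\sum_{i=0}^{t_{2}}(-1)^{i}(l - i)!\binom{t_{2}}{i},$$ $$B(\lambda, k, l, t_{1}) = \sum_{t_{3} = 0}^{k - t_{1}}\left(\binom{k - t_{1}}{t_{3}}\binom{\lambda - n + t_{1}}{k - t_{3}}\sum_{j=0}^{t_{3}}(-1)^{j}(k - j)!\binom{t_{3}}{j}\right).$$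
   Context: Graphs are finite and simple. For a graph $G$ and a natural number $\lambda$, the chromatic polynomial $P(G,\lambda)$ is the number of proper vertex colorings of $G$ using colors from $\{1,2,\dots,\lambda\}$ (not all colors need be used). The line graph of a graph has one vertex for each edge of that graph, two vertices being adjacent if and only if the corresponding edges are distinct and share an endpoint. Thus $G(n)$, the line graph of $K_{3,n}$, is the Cartesian product $K_3 \Box K_n$: its vertices are $x_j^i$ with $1\le i\le 3$, $1\le j\le n$, and two distinct vertices $x_j^i$, $x_{j'}^{i'}$ are adjacent if and only if $i=i'$ or $j=j'$. We write $g(n,\lambda)=P(G(n),\lambda)$; this equals the number of $3\times n$ arrays with entries in $\{1,\dots,\lambda\}$ in which each entry appears at most once in each row and each column. Binomial coefficients $\binom{a}{c}$ with integers $0\le a<c$ are $0$. *)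

theory Defs
  imports Complex_Main "HOL-Library.FuncSet" "Graph_Theory.Kuratowski"
begin

text \<open>
  Finite simple graphs are the locale \<open>graph\<close>: finite symmetric digraphs without loops or parallel
  arcs. An undirected edge \<open>{u, v}\<close> corresponds to the pair of opposite arcs \<open>(u, v)\<close> and \<open>(v, u)\<close>.
\<close>

definition undirected_edges :: "('a, 'b) pre_digraph \<Rightarrow> 'a set set" where
  "undirected_edges G = {{u, v} | u v. (u, v) \<in> arcs_ends G}"

definition line_graph :: "('a, 'b) pre_digraph \<Rightarrow> 'a set pair_pre_digraph" where
  "line_graph G =
     \<lparr> pverts = undirected_edges G,
       parcs = {(e, f). e \<in> undirected_edges G \<and> f \<in> undirected_edges G \<and> e \<noteq> f \<and> e \<inter> f \<noteq> {}} \<rparr>"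

text \<open>
  Colourings are extensional (\<open>\<rightarrow>\<^sub>E\<close>), so that maps differing only outside the vertex set are not
  counted separately.
\<close>

definition proper_colorings :: "('a, 'b) pre_digraph \<Rightarrow> nat \<Rightarrow> ('a \<Rightarrow> nat) set" where
  "proper_colorings G q =
     {c \<in> verts G \<rightarrow>\<^sub>E {1..q}. \<forall>(u, v) \<in> arcs_ends G. c u \<noteq> c v}"

definition chromatic_polynomial :: "('a, 'b) pre_digraph \<Rightarrow> nat \<Rightarrow> nat" where
  "chromatic_polynomial G q = card (proper_colorings G q)"

text \<open>
  The number \<open>n\<close> in both coefficients is \<open>k + l\<close>. In the index ranges in which they are used
  (with \<open>n \<le> q\<close>), no subtraction of natural numbers below is truncated.
\<close>

definition coeff_A :: "nat \<Rightarrow> nat \<Rightarrow> nat \<Rightarrow> nat \<Rightarrow> nat \<Rightarrow> int" where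
  "coeff_A q k l t\<^sub>1 t\<^sub>2 = (let n = k + l in
     int (k choose t\<^sub>1) * int (l choose t\<^sub>2) * int ((q - n) choose (l - t\<^sub>1 - t\<^sub>2)) *
     (\<Sum>i = 0..t\<^sub>2. (-1) ^ i * fact (l - i) * int (t\<^sub>2 choose i)))"

definition coeff_B :: "nat \<Rightarrow> nat \<Rightarrow> nat \<Rightarrow> nat \<Rightarrow> int" where
  "coeff_B q k l t\<^sub>1 = (let n = k + l in
     \<Sum>t\<^sub>3 = 0..k - t\<^sub>1.
       int ((k - t\<^sub>1) choose t\<^sub>3) * int ((q - n + t\<^sub>1) choose (k - t\<^sub>3)) *
       (\<Sum>j = 0..t\<^sub>3. (-1) ^ j * fact (k - j) * int (t\<^sub>3 choose j)))"

lemma graph_line_graph: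
  assumes "graph G"
  shows "graph (with_proj (line_graph G))"
proof -
  interpret graph G by fact
  have "undirected_edges G \<subseteq> (\<lambda>(u, v). {u, v}) ` arcs_ends G"
    by (auto simp: undirected_edges_def)
  moreover have "finite (arcs_ends G)"
    by (simp add: arcs_ends_def)
  ultimately have fin: "finite (undirected_edges G)"
    by (meson finite_imageI finite_subset)
  have "finite (parcs (line_graph G))"
    by (rule finite_subset[of _ "undirected_edges G \<times> undirected_edges G"])
      (auto simp: line_graph_def fin)
  then interpret L: pair_graph "line_graph G"
    by unfold_locales (auto simp: line_graph_def fin symmetric_def intro!: symI)
  show ?thesis
    by unfold_locales
qed

lemma ex_complete_bipartite:
  "\<exists>G :: (nat + nat) pair_pre_digraph. complete_bipartite_digraph m n (with_proj G)"
proof -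
  let ?U = "Inl ` {..<m} :: (nat + nat) set" and ?V = "Inr ` {..<n} :: (nat + nat) set"
  have "card ?U = m" "card ?V = n"
    by (simp_all add: card_image)
  then show ?thesis
    unfolding complete_bipartite_digraph_pair_def
    by (intro exI[of _ "\<lparr>pverts = ?U \<union> ?V, parcs = ?U \<times> ?V \<union> ?V \<times> ?U\<rparr>"] conjI
        exI[of _ ?U] exI[of _ ?V]) auto
qed

end

theory Submission
  imports Defs
begin

text \<open>
  Name the three vertices on the small side of \<open>K\<^bsub>3,n\<^esub>\<close> as rows and the set \<open>V\<close> of the other \<open>n\<close>
  vertices as columns. A proper colouring of the line graph is then an array with three rows and
  \<open>n\<close> columns whose entries are distinct within every row and within every column
  (\<open>bij_betw_rows\<close>). The first row is any injection \<open>\<rho>\<close> of the columns into the \<open>q\<close> colours,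
  which gives the factor \<open>q! / (q - n)!\<close>. What remains is to count, for a fixed \<open>\<rho>\<close>, the pairs of
  injections that avoid \<open>\<rho>\<close> in every column and avoid each other in every column; the count turns
  out not to depend on \<open>\<rho>\<close> (\<open>card_completions\<close>).

  The condition that the two rows differ everywhere is removed by inclusion-exclusion over the set
  \<open>L\<close> of \<open>l\<close> columns in which they are forced to agree. Given their common part \<open>f\<close> on \<open>L\<close>, the two
  rows no longer interact: each is an extension of \<open>f\<close> to the \<open>k = n - l\<close> remaining columns, chosen
  independently of the other, so \<open>f\<close> contributes the square of the number of its extensions
  (\<open>card_agreeing_pairs\<close>).

  An extension is an injection of \<open>V - L\<close> into the colours not used by \<open>f\<close>, avoiding \<open>\<rho>\<close>. A colour
  restricts such an injection only if it is one of the \<open>k\<close> values of \<open>\<rho>\<close> on \<open>V - L\<close>. If \<open>f\<close> uses up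
  \<open>t\<^sub>1\<close> of these, then \<open>k - t\<^sub>1\<close> restricting colours and \<open>q - n + t\<^sub>1\<close> free ones remain. Choosing the
  image with \<open>t\<^sub>3\<close> restricting colours, and then a bijection onto it in which \<open>t\<^sub>3\<close> points each avoid
  one value, gives \<open>coeff_B\<close> (\<open>card_avoiding_complement\<close>). The functions \<open>f\<close> themselves are counted
  in the same way, with their images now classified by the number \<open>t\<^sub>1\<close> of colours from
  \<open>\<rho> ` (V - L)\<close> and the number \<open>t\<^sub>2\<close> of colours from \<open>\<rho> ` L\<close>; only the latter restrict \<open>f\<close>, which
  gives \<open>coeff_A\<close> (\<open>sum_squared_extensions\<close>).
\<close>

section \<open>Sums over subsets\<close>

text \<open>
  Inclusion-exclusion. The indicator of \<open>\<forall>x\<in>X. \<not> P x h\<close> is the product of the factors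
  \<open>1 - of_bool (P x h)\<close>, and multiplying this product out gives one signed term for every subset.
\<close>

lemma card_sieve:
  assumes "finite H" "finite X"
  shows "int (card {h \<in> H. \<forall>x\<in>X. \<not> P x h}) =
    (\<Sum>S\<in>Pow X. (-1) ^ card S * int (card {h \<in> H. \<forall>x\<in>S. P x h}))"
proof -
  have all: "(\<Prod>x\<in>S. of_bool (Q x)) = (of_bool (\<forall>x\<in>S. Q x) :: int)" if "finite S" for S Q
    using that by (induction S) auto
  have sub: "finite S" if "S \<in> Pow X" for S
    using that assms(2) finite_subset by auto
  have "int (card {h \<in> H. \<forall>x\<in>X. \<not> P x h}) = (\<Sum>h\<in>H. of_bool (\<forall>x\<in>X. \<not> P x h))"
    using assms(1) by (simp add: of_bool_def sum.If_cases Int_def)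
  also have "\<dots> = (\<Sum>h\<in>H. \<Prod>x\<in>X. 1 - of_bool (P x h))"
    using assms(2) by (intro sum.cong refl) (simp flip: all of_bool_not_iff)
  also have "\<dots> = (\<Sum>h\<in>H. \<Sum>S\<in>Pow X. (-1) ^ card S * of_bool (\<forall>x\<in>S. P x h))"
    using assms(2) sub by (intro sum.cong refl) (simp add: prod_diff_conv_sum all)
  also have "\<dots> = (\<Sum>S\<in>Pow X. (-1) ^ card S * (\<Sum>h\<in>H. of_bool (\<forall>x\<in>S. P x h)))"
    by (subst sum.swap) (simp add: sum_distrib_left)
  also have "\<dots> = (\<Sum>S\<in>Pow X. (-1) ^ card S * int (card {h \<in> H. \<forall>x\<in>S. P x h}))"
    using assms(1) by (simp add: of_bool_def sum.If_cases Int_def)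
  finally show ?thesis .
qed

lemma sum_subsets_by_card:
  fixes \<psi> :: "nat \<Rightarrow> int"
  assumes "finite A"
  shows "(\<Sum>S | S \<subseteq> A \<and> card S \<le> m. \<psi> (card S)) =
    (\<Sum>i = 0..min (card A) m. int (card A choose i) * \<psi> i)"
proof -
  have "(\<Sum>S | S \<subseteq> A \<and> card S \<le> m. \<psi> (card S)) =
      (\<Sum>i = 0..min (card A) m. \<Sum>S | S \<in> {S. S \<subseteq> A \<and> card S \<le> m} \<and> card S = i. \<psi> (card S))"
    using assms by (intro sum.group[symmetric]) (auto simp: card_mono)
  also have "\<dots> = (\<Sum>i = 0..min (card A) m. int (card A choose i) * \<psi> i)"
  proof (intro sum.cong refl)
    fix i assume i: "i \<in> {0..min (card A) m}"
    then have *: "{S. S \<in> {S. S \<subseteq> A \<and> card S \<le> m} \<and> card S = i} = {S. S \<subseteq> A \<and> card S = i}"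
      by auto
    show "(\<Sum>S | S \<in> {S. S \<subseteq> A \<and> card S \<le> m} \<and> card S = i. \<psi> (card S)) =
        int (card A choose i) * \<psi> i"
      unfolding * using n_subsets[OF assms, of i] by simp
  qed
  finally show ?thesis .
qed

corollary sum_Pow_by_card:
  fixes \<psi> :: "nat \<Rightarrow> int"
  assumes "finite A"
  shows "(\<Sum>S\<in>Pow A. \<psi> (card S)) = (\<Sum>i = 0..card A. int (card A choose i) * \<psi> i)"
proof -
  have "Pow A = {S. S \<subseteq> A \<and> card S \<le> card A}"
    using assms by (auto simp: card_mono)
  then show ?thesis
    using sum_subsets_by_card[OF assms, of \<psi> "card A"] by simp
qed

text \<open>
  A subset of a disjoint union is a pair of subsets. The second block enters through the set
  \<open>Z \<inter> B\<close> and not merely through its size, so that the rule can be applied again to a \<open>B\<close> that is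
  itself a disjoint union.
\<close>

lemma sum_subsets_split_block:
  fixes \<phi> :: "nat \<Rightarrow> 'a set \<Rightarrow> int"
  assumes "finite A" "finite B" "A \<inter> B = {}"
  shows "(\<Sum>Z | Z \<subseteq> A \<union> B \<and> card Z = m. \<phi> (card (Z \<inter> A)) (Z \<inter> B)) =
    (\<Sum>i = 0..min (card A) m. int (card A choose i) * (\<Sum>W | W \<subseteq> B \<and> card W = m - i. \<phi> i W))"
proof -
  let ?D = "{S. S \<subseteq> A \<and> card S \<le> m}" and ?E = "\<lambda>S. {W. W \<subseteq> B \<and> card W = m - card S}"
  have card_Un: "card (S \<union> W) = card S + card W" if "S \<subseteq> A" "W \<subseteq> B" for S W
    using that assms by (intro card_Un_disjoint) (auto dest: finite_subset)
  have card_split: "card Z = card (Z \<inter> A) + card (Z \<inter> B)" if "Z \<subseteq> A \<union> B" for Z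
  proof -
    have "Z = (Z \<inter> A) \<union> (Z \<inter> B)"
      using that by auto
    then show ?thesis
      by (metis card_Un inf_le2)
  qed
  have "(\<Sum>Z | Z \<subseteq> A \<union> B \<and> card Z = m. \<phi> (card (Z \<inter> A)) (Z \<inter> B)) =
      (\<Sum>(S, W)\<in>Sigma ?D ?E. \<phi> (card S) W)"
  proof (rule sum.reindex_bij_witness[of _ "\<lambda>(S, W). S \<union> W" "\<lambda>Z. (Z \<inter> A, Z \<inter> B)"], goal_cases)
    case (2 Z)
    then show ?case
      using card_split[of Z] by auto
  next
    case (4 p)
    then show ?case
      using card_Un[of "fst p" "snd p"] by (auto simp: split_beta)
  qed (use assms(3) in auto)
  also have "\<dots> = (\<Sum>S\<in>?D. \<Sum>W\<in>?E S. \<phi> (card S) W)"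
    using assms by (intro sum.Sigma[symmetric]) auto
  also have "\<dots> = (\<Sum>i = 0..min (card A) m. int (card A choose i) *
      (\<Sum>W | W \<subseteq> B \<and> card W = m - i. \<phi> i W))"
    by (rule sum_subsets_by_card[OF assms(1)])
  finally show ?thesis .
qed

section \<open>Injections with a pointwise constraint\<close>

definition injections :: "('a \<Rightarrow> 'b \<Rightarrow> bool) \<Rightarrow> 'a set \<Rightarrow> 'b set \<Rightarrow> ('a \<Rightarrow> 'b) set" where
  "injections P X Y = {h \<in> X \<rightarrow>\<^sub>E Y. inj_on h X \<and> (\<forall>x\<in>X. P x (h x))}"

abbreviation avoiding :: "('a \<Rightarrow> 'b) \<Rightarrow> 'a set \<Rightarrow> 'b set \<Rightarrow> ('a \<Rightarrow> 'b) set" where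
  "avoiding \<rho> \<equiv> injections (\<lambda>x y. y \<noteq> \<rho> x)"

lemma finite_injections: "finite X \<Longrightarrow> finite Y \<Longrightarrow> finite (injections P X Y)"
  unfolding injections_def by (simp add: finite_PiE)

lemma restrict_in_injections:
  "h \<in> injections P X Y \<Longrightarrow> L \<subseteq> X \<Longrightarrow> restrict h L \<in> injections P L Y"
  unfolding injections_def by (auto intro: inj_on_subset)

text \<open>
  Extending \<open>f\<close> from \<open>L\<close> to \<open>X\<close> is the same as choosing a constrained injection on \<open>X - L\<close> into the
  values that \<open>f\<close> leaves unused: the two parts are glued along the partition of \<open>X\<close>.
\<close>

lemma card_extensions:
  assumes "L \<subseteq> X" "f \<in> injections P L Y"
  shows "card {h \<in> injections P X Y. restrict h L = f} = card (injections P (X - L) (Y - f ` L))"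
proof (rule bij_betw_same_card, rule bij_betwI)
  let ?glue = "\<lambda>g x. if x \<in> L then f x else g x"
  show "(\<lambda>h. restrict h (X - L)) \<in>
      {h \<in> injections P X Y. restrict h L = f} \<rightarrow> injections P (X - L) (Y - f ` L)"
  proof
    fix h assume h: "h \<in> {h \<in> injections P X Y. restrict h L = f}"
    then have inj: "inj_on h X" and f: "f ` L = h ` L"
      by (auto simp: injections_def)
    have "h x \<notin> f ` L" if "x \<in> X - L" for x
      using that inj assms(1) unfolding f by (auto dest: inj_onD)
    then show "restrict h (X - L) \<in> injections P (X - L) (Y - f ` L)"
      using h inj by (auto simp: injections_def PiE_iff intro: inj_on_subset)
  qed
  show "?glue \<in> injections P (X - L) (Y - f ` L) \<rightarrow> {h \<in> injections P X Y. restrict h L = f}"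
  proof
    fix g assume g: "g \<in> injections P (X - L) (Y - f ` L)"
    have "g ` (X - L) \<subseteq> Y - f ` L"
      using g by (auto simp: injections_def)
    then have "inj_on f L" "inj_on g (X - L)" "f ` L \<inter> g ` (X - L) = {}"
      using assms(2) g by (auto simp: injections_def)
    then have "inj_on (?glue g) (L \<union> (X - L))"
      by (rule inj_on_disjoint_Un)
    moreover have "L \<union> (X - L) = X"
      using assms(1) by auto
    ultimately have "inj_on (?glue g) X"
      by simp
    moreover have "?glue g \<in> X \<rightarrow>\<^sub>E Y"
      using assms g unfolding injections_def PiE_iff extensional_def by auto
    moreover have "restrict (?glue g) L = f"
      using assms(2) unfolding injections_def by (auto simp: fun_eq_iff PiE_iff extensional_def)
    ultimately show "?glue g \<in> {h \<in> injections P X Y. restrict h L = f}"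
      using assms g unfolding injections_def by auto
  qed
  show "?glue (restrict h (X - L)) = h" if "h \<in> {h \<in> injections P X Y. restrict h L = f}" for h
  proof -
    have "f = restrict h L" "h \<in> extensional X"
      using that by (auto simp: injections_def PiE_iff)
    then show ?thesis
      using assms(1) by (auto simp: fun_eq_iff extensional_def)
  qed
  show "restrict (?glue g) (X - L) = g" if "g \<in> injections P (X - L) (Y - f ` L)" for g
    using that unfolding injections_def by (auto simp: fun_eq_iff PiE_iff extensional_def)
qed

text \<open>
  The falling factorial, stated as a product so that it stays within the natural numbers. In the
  induction the new point is an extension in the sense of \<open>card_extensions\<close>, with
  \<open>card Y - card X\<close> values to choose from.
\<close>

lemma card_injections_unconstrained:
  assumes "finite X" "finite Y" "card X \<le> card Y"
  shows "card (injections (\<lambda>_ _. True) X Y) * fact (card Y - card X) = fact (card Y)"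
  using assms(1,3)
proof (induction X)
  case empty
  then show ?case
    by (simp add: injections_def)
next
  case (insert x X)
  let ?I = "injections (\<lambda>_ _. True)"
  have one: "card (?I {x} (Y - f ` X)) = card Y - card X" if "f \<in> ?I X Y" for f
  proof -
    have "?I {x} (Y - f ` X) = {x} \<rightarrow>\<^sub>E (Y - f ` X)"
      by (auto simp: injections_def)
    moreover have "f ` X \<subseteq> Y" "card (f ` X) = card X"
      using that by (auto simp: injections_def card_image)
    ultimately show ?thesis
      using assms(2) by (simp add: card_PiE card_Diff_subset finite_subset)
  qed
  have "card (?I (insert x X) Y) = (\<Sum>f\<in>?I X Y. card {h \<in> ?I (insert x X) Y. restrict h X = f})"
  proof -
    have "(\<lambda>h. restrict h X) ` ?I (insert x X) Y \<subseteq> ?I X Y"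
      using restrict_in_injections[of _ "\<lambda>_ _. True" "insert x X" Y X] by blast
    then show ?thesis
      using insert.hyps assms(2)
        sum.group[of "?I (insert x X) Y" "?I X Y" "\<lambda>h. restrict h X" "\<lambda>_. 1::nat"]
      by (simp add: finite_injections)
  qed
  also have "\<dots> = card (?I X Y) * (card Y - card X)"
    using insert.hyps one by (simp add: card_extensions subset_insertI insert_Diff_if)
  finally have "card (?I (insert x X) Y) * fact (card Y - card (insert x X)) =
      card (?I X Y) * ((card Y - card X) * fact (card Y - card X - 1))"
    using insert.hyps by simp
  also have "\<dots> = card (?I X Y) * fact (card Y - card X)"
    using insert.hyps insert.prems fact_reduce[of "card Y - card X", where 'a = nat] by simp
  also have "\<dots> = fact (card Y)"
    using insert by simp
  finally show ?case .
qed

text \<open>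
  The injections with image \<open>Z\<close> are exactly the injections into \<open>Z\<close>, because \<open>Z\<close> has only as many
  elements as \<open>X\<close>. This reduces the counting of injections to the counting of bijections. The weight
  \<open>w\<close> lets later factors depend on the colours that have been used.
\<close>

lemma sum_injections_by_image:
  fixes w :: "'b set \<Rightarrow> int"
  assumes "finite X" "finite Y"
  shows "(\<Sum>f\<in>injections P X Y. w (f ` X)) =
    (\<Sum>Z | Z \<subseteq> Y \<and> card Z = card X. int (card (injections P X Z)) * w Z)"
proof -
  let ?\<Z> = "{Z. Z \<subseteq> Y \<and> card Z = card X}"
  have fibre: "{f \<in> injections P X Y. f ` X = Z} = injections P X Z" if "Z \<in> ?\<Z>" for Z
  proof -
    have "f ` X = Z" if "f \<in> injections P X Z" for f
    proof (rule card_subset_eq)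
      show "finite Z"
        using \<open>Z \<in> ?\<Z>\<close> assms(2) finite_subset by blast
    qed (use that \<open>Z \<in> ?\<Z>\<close> in \<open>auto simp: injections_def card_image\<close>)
    moreover have "injections P X Z \<subseteq> injections P X Y"
      using that PiE_mono[of X "\<lambda>_. Z" "\<lambda>_. Y"] by (auto simp: injections_def)
    moreover have "f \<in> injections P X Z" if "f \<in> injections P X Y" "f ` X = Z" for f
      using that by (auto simp: injections_def PiE_iff)
    ultimately show ?thesis
      by blast
  qed
  have "(\<Sum>f\<in>injections P X Y. w (f ` X)) =
      (\<Sum>Z\<in>?\<Z>. \<Sum>f | f \<in> injections P X Y \<and> f ` X = Z. w (f ` X))"
    using assms
    by (intro sum.group[symmetric] finite_injections) (auto simp: injections_def card_image)
  also have "\<dots> = (\<Sum>Z\<in>?\<Z>. int (card (injections P X Z)) * w Z)"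
    by (intro sum.cong refl) (simp add: fibre[symmetric])
  finally show ?thesis .
qed

section \<open>Injections avoiding a prescribed value at each point\<close>

text \<open>
  The number of permutations of \<open>m\<close> objects without a fixed point among \<open>t\<close> given objects, in the
  form in which inclusion-exclusion produces it (for \<open>t \<le> m\<close>; these are the derangements if
  \<open>t = m\<close>).
\<close>

definition partial_derangements :: "nat \<Rightarrow> nat \<Rightarrow> int" where
  "partial_derangements m t = (\<Sum>i = 0..t. (-1) ^ i * fact (m - i) * int (t choose i))"

text \<open>
  Only those points matter whose forbidden value lies in \<open>Y\<close>. Inclusion-exclusion runs over the
  set \<open>S\<close> of points that are forced to take their forbidden value: a set \<open>S\<close> of such points leaves
  \<open>(card X - card S)!\<close> ways to complete the bijection, while any other \<open>S\<close> leaves none.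
\<close>

lemma card_avoiding_bijections:
  assumes "finite X" "finite Y" "card Y = card X" "inj_on \<rho> X"
  shows "int (card (avoiding \<rho> X Y)) = partial_derangements (card X) (card (Y \<inter> \<rho> ` X))"
proof -
  let ?I = "injections (\<lambda>_ _. True)"
  define T where "T = {x \<in> X. \<rho> x \<in> Y}"
  have "finite T" and "T \<subseteq> X"
    using assms(1) by (auto simp: T_def)
  have "Y \<inter> \<rho> ` X = \<rho> ` T"
    by (auto simp: T_def)
  then have card_T: "card (Y \<inter> \<rho> ` X) = card T"
    using assms(4) by (auto simp: T_def intro: card_image inj_on_subset)
  have inside: "card {h \<in> ?I X Y. \<forall>x\<in>S. h x = \<rho> x} = fact (card X - card S)" if "S \<in> Pow T" for S
  proof -
    have S: "S \<subseteq> X" "\<rho> ` S \<subseteq> Y" "inj_on \<rho> S" "finite S"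
      using that assms by (auto simp: T_def intro: inj_on_subset finite_subset)
    have "{h \<in> ?I X Y. \<forall>x\<in>S. h x = \<rho> x} = {h \<in> ?I X Y. restrict h S = restrict \<rho> S}"
      by (auto simp: fun_eq_iff restrict_def)
    also have "card \<dots> = card (?I (X - S) (Y - \<rho> ` S))"
      using S card_extensions[of S X "restrict \<rho> S" "\<lambda>_ _. True" Y]
      by (auto simp: injections_def)
    also have "\<dots> = fact (card X - card S)"
      using card_injections_unconstrained[of "X - S" "Y - \<rho> ` S"] S assms
      by (simp add: card_Diff_subset card_image)
    finally show ?thesis .
  qed
  have outside: "{h \<in> ?I X Y. \<forall>x\<in>S. h x = \<rho> x} = {}" if S: "S \<in> Pow X - Pow T" for S
  proof -
    obtain x where "x \<in> S" "x \<in> X" "\<rho> x \<notin> Y"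
      using S unfolding T_def by blast
    then have "h x \<noteq> \<rho> x" if "h \<in> ?I X Y" for h
      using that by (auto simp: injections_def PiE_iff)
    then show ?thesis
      using \<open>x \<in> S\<close> by blast
  qed
  have "avoiding \<rho> X Y = {h \<in> ?I X Y. \<forall>x\<in>X. \<not> h x = \<rho> x}"
    by (auto simp: injections_def)
  then have "int (card (avoiding \<rho> X Y)) =
      (\<Sum>S\<in>Pow X. (-1) ^ card S * int (card {h \<in> ?I X Y. \<forall>x\<in>S. h x = \<rho> x}))"
    using card_sieve[of "?I X Y" X "\<lambda>x h. h x = \<rho> x"] assms by (simp add: finite_injections)
  also have "\<dots> = (\<Sum>S\<in>Pow T. (-1) ^ card S * int (card {h \<in> ?I X Y. \<forall>x\<in>S. h x = \<rho> x}))"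
    using assms(1) \<open>T \<subseteq> X\<close> by (intro sum.mono_neutral_right ballI) (auto simp: outside)
  also have "\<dots> = (\<Sum>S\<in>Pow T. (-1) ^ card S * fact (card X - card S))"
    by (intro sum.cong refl) (simp add: inside)
  also have "\<dots> = partial_derangements (card X) (card (Y \<inter> \<rho> ` X))"
    using sum_Pow_by_card[OF \<open>finite T\<close>, of "\<lambda>i. (-1) ^ i * fact (card X - i)"]
    by (simp add: partial_derangements_def card_T mult.commute)
  finally show ?thesis .
qed

lemma sum_avoiding_by_image:
  fixes w :: "'b set \<Rightarrow> int"
  assumes "finite X" "finite Y" "inj_on \<rho> X"
  shows "(\<Sum>f\<in>avoiding \<rho> X Y. w (f ` X)) =
    (\<Sum>Z | Z \<subseteq> Y \<and> card Z = card X. partial_derangements (card X) (card (Z \<inter> \<rho> ` X)) * w Z)"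
  unfolding sum_injections_by_image[OF assms(1,2)]
  using assms by (intro sum.cong refl) (auto simp: card_avoiding_bijections finite_subset)

text \<open>
  The summation index is the number of forbidden values that occur in the image of the injection.
\<close>

lemma card_avoiding:
  assumes "finite X" "finite Y" "inj_on \<rho> X"
  defines "a \<equiv> card (Y \<inter> \<rho> ` X)"
  shows "int (card (avoiding \<rho> X Y)) =
    (\<Sum>t = 0..a. int (a choose t) * int (card (Y - \<rho> ` X) choose (card X - t)) *
      partial_derangements (card X) t)"
proof -
  let ?m = "card X" and ?A = "Y \<inter> \<rho> ` X" and ?B = "Y - \<rho> ` X"
  have "a \<le> card (\<rho> ` X)"
    unfolding a_def using assms(1) by (intro card_mono) auto
  then have "a \<le> ?m"
    using assms(3) by (simp add: card_image)
  have "int (card (avoiding \<rho> X Y)) =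
      (\<Sum>Z | Z \<subseteq> Y \<and> card Z = ?m. partial_derangements ?m (card (Z \<inter> \<rho> ` X)))"
    using sum_avoiding_by_image[OF assms(1-3), of "\<lambda>_. 1"] by simp
  also have "\<dots> = (\<Sum>Z | Z \<subseteq> ?A \<union> ?B \<and> card Z = ?m. partial_derangements ?m (card (Z \<inter> ?A)))"
    by (intro sum.cong arg_cong2[of _ _ _ _ partial_derangements] arg_cong[of _ _ card]) auto
  also have "\<dots> = (\<Sum>t = 0..min (card ?A) ?m. int (card ?A choose t) *
      (\<Sum>W | W \<subseteq> ?B \<and> card W = ?m - t. partial_derangements ?m t))"
    using assms(2)
    by (intro sum_subsets_split_block[where \<phi> = "\<lambda>i _. partial_derangements ?m i"]) auto
  also have "\<dots> = (\<Sum>t = 0..a. int (a choose t) * int (card ?B choose (?m - t)) *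
      partial_derangements ?m t)"
    using assms(2) \<open>a \<le> ?m\<close> by (simp add: n_subsets mult.assoc flip: a_def)
  finally show ?thesis .
qed

section \<open>Counting the second and third rows\<close>

lemma coeff_B_eq:
  "coeff_B q k l t\<^sub>1 = (\<Sum>t = 0..k - t\<^sub>1. int ((k - t\<^sub>1) choose t) *
    int ((q - (k + l) + t\<^sub>1) choose (k - t)) * partial_derangements k t)"
  by (simp add: coeff_B_def partial_derangements_def Let_def)

lemma coeff_A_eq:
  "coeff_A q k l t\<^sub>1 t\<^sub>2 = int (k choose t\<^sub>1) * int (l choose t\<^sub>2) *
    int ((q - (k + l)) choose (l - t\<^sub>1 - t\<^sub>2)) * partial_derangements l t\<^sub>2"
  by (simp add: coeff_A_def partial_derangements_def Let_def)

context
  fixes V :: "'a set" and C :: "'c set" and \<rho> :: "'a \<Rightarrow> 'c" and L :: "'a set" and k l :: nat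
  assumes finite: "finite V" "finite C"
    and \<rho>: "inj_on \<rho> V" "\<rho> ` V \<subseteq> C"
    and L: "L \<subseteq> V"
    and card_L: "card L = l" and card_K: "card (V - L) = k"
begin

lemma card_V: "card V = k + l"
  using card_Diff_subset[of L V] card_mono[of V L] L finite card_L card_K
  by (auto dest: finite_subset)

lemma card_images: "card (\<rho> ` V) = k + l" "card (\<rho> ` L) = l" "card (\<rho> ` (V - L)) = k"
proof -
  have "inj_on \<rho> L" "inj_on \<rho> (V - L)"
    using \<rho>(1) L by (auto intro: inj_on_subset)
  then show "card (\<rho> ` V) = k + l" "card (\<rho> ` L) = l" "card (\<rho> ` (V - L)) = k"
    using \<rho>(1) card_L card_K card_V by (auto simp: card_image)
qed

text \<open>
  Here \<open>Z\<close> is the set of colours used on \<open>L\<close>. With \<open>t\<close> of them in \<open>\<rho> ` (V - L)\<close>, the \<open>card C - l\<close>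
  colours that are left consist of \<open>k - t\<close> forbidden values and \<open>card C - (k + l) + t\<close> other colours.
\<close>

lemma card_avoiding_complement:
  assumes "Z \<subseteq> C" "card Z = l"
  shows "int (card (avoiding \<rho> (V - L) (C - Z))) =
    coeff_B (card C) k l (card (Z \<inter> \<rho> ` (V - L)))"
proof -
  let ?R = "\<rho> ` (V - L)" and ?t = "card (Z \<inter> \<rho> ` (V - L))"
  have fin: "finite Z" "finite ?R"
    using assms(1) finite by (auto dest: finite_subset)
  have R: "?R \<subseteq> C"
    using \<rho>(2) by auto
  have "card ((C - Z) \<inter> ?R) = card (?R - Z \<inter> ?R)"
    using R by (intro arg_cong[of _ _ card]) auto
  also have "\<dots> = k - ?t"
    using fin by (simp add: card_Diff_subset card_images)
  finally have restricted: "card ((C - Z) \<inter> ?R) = k - ?t" .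
  have t: "?t \<le> k" "?t \<le> l"
    using fin assms(2) card_images(3) card_mono[of ?R "Z \<inter> ?R"] card_mono[of Z "Z \<inter> ?R"] by auto
  have C: "k + l \<le> card C"
    using card_mono[OF finite(2) \<rho>(2)] card_images(1) by simp
  have "card (Z \<union> ?R) + ?t = k + l"
    using card_Un_Int[OF fin] assms(2) card_images(3) by simp
  moreover have "card (C - Z - ?R) = card C - card (Z \<union> ?R)"
    using fin R assms(1) card_Diff_subset[of "Z \<union> ?R" C] by (simp add: set_diff_eq conj_ac)
  ultimately have free: "card (C - Z - ?R) = card C - (k + l) + ?t"
    using t C by simp
  have "inj_on \<rho> (V - L)"
    using \<rho>(1) by (auto intro: inj_on_subset)
  then show ?thesis
    using card_avoiding[of "V - L" "C - Z" \<rho>] finite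
    by (simp add: restricted free card_K coeff_B_eq)
qed

text \<open>
  The colours split into \<open>\<rho> ` (V - L)\<close>, \<open>\<rho> ` L\<close> and the colours outside the range of \<open>\<rho>\<close>. The
  number of extensions of \<open>f\<close> depends only on how many colours \<open>f\<close> takes from the first block, and
  the number of \<open>f\<close> with a given image only on how many colours of the second block this image has.
\<close>

lemma sum_squared_extensions:
  "(\<Sum>f\<in>avoiding \<rho> L C. (int (card (avoiding \<rho> (V - L) (C - f ` L))))\<^sup>2) =
    (\<Sum>t\<^sub>1 = 0..min k l. \<Sum>t\<^sub>2 = 0..l - t\<^sub>1.
      coeff_A (card C) k l t\<^sub>1 t\<^sub>2 * (coeff_B (card C) k l t\<^sub>1)\<^sup>2)"
proof -
  let ?q = "card C" and ?P = "\<rho> ` (V - L)" and ?Q = "\<rho> ` L" and ?F = "C - \<rho> ` V"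
  have fin: "finite L" "finite ?P" "finite ?Q" "finite ?F"
    using L finite by (auto dest: finite_subset)
  have blocks: "C = ?P \<union> (?Q \<union> ?F)" "?P \<inter> (?Q \<union> ?F) = {}" "?Q \<inter> ?F = {}"
    using L \<rho> by (auto dest: inj_onD)
  have card_F: "card ?F = ?q - (k + l)"
    using finite \<rho>(2) card_images(1) by (simp add: card_Diff_subset)
  have injL: "inj_on \<rho> L"
    using \<rho>(1) L by (rule inj_on_subset)
  have image: "f ` L \<subseteq> C \<and> card (f ` L) = l" if "f \<in> avoiding \<rho> L C" for f
    using that card_L by (auto simp: injections_def card_image)
  have "(\<Sum>f\<in>avoiding \<rho> L C. (int (card (avoiding \<rho> (V - L) (C - f ` L))))\<^sup>2) =
      (\<Sum>f\<in>avoiding \<rho> L C. (coeff_B ?q k l (card (f ` L \<inter> ?P)))\<^sup>2)"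
    using image by (intro sum.cong refl) (simp add: card_avoiding_complement)
  also have "\<dots> = (\<Sum>Z | Z \<subseteq> C \<and> card Z = l.
      partial_derangements l (card (Z \<inter> ?Q)) * (coeff_B ?q k l (card (Z \<inter> ?P)))\<^sup>2)"
    using sum_avoiding_by_image[OF fin(1) finite(2) injL,
        of "\<lambda>Z. (coeff_B ?q k l (card (Z \<inter> ?P)))\<^sup>2"]
    by (simp add: card_L)
  also have "\<dots> = (\<Sum>Z | Z \<subseteq> ?P \<union> (?Q \<union> ?F) \<and> card Z = l.
      partial_derangements l (card ((Z \<inter> (?Q \<union> ?F)) \<inter> ?Q)) * (coeff_B ?q k l (card (Z \<inter> ?P)))\<^sup>2)"
  proof -
    have "(Z \<inter> (?Q \<union> ?F)) \<inter> ?Q = Z \<inter> ?Q" for Z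
      by auto
    then show ?thesis
      by (simp only: blocks(1)[symmetric])
  qed
  also have "\<dots> = (\<Sum>t\<^sub>1 = 0..min k l. int (k choose t\<^sub>1) *
      (\<Sum>W | W \<subseteq> ?Q \<union> ?F \<and> card W = l - t\<^sub>1.
        partial_derangements l (card (W \<inter> ?Q)) * (coeff_B ?q k l t\<^sub>1)\<^sup>2))"
    using sum_subsets_split_block[of ?P "?Q \<union> ?F"
        "\<lambda>i W. partial_derangements l (card (W \<inter> ?Q)) * (coeff_B ?q k l i)\<^sup>2" l]
      fin blocks(2) card_images(3) by simp
  also have "\<dots> = (\<Sum>t\<^sub>1 = 0..min k l. int (k choose t\<^sub>1) *
      (\<Sum>t\<^sub>2 = 0..l - t\<^sub>1. int (l choose t\<^sub>2) * (\<Sum>W | W \<subseteq> ?F \<and> card W = l - t\<^sub>1 - t\<^sub>2.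
        partial_derangements l t\<^sub>2 * (coeff_B ?q k l t\<^sub>1)\<^sup>2)))"
    using fin blocks(3) card_images(2)
    by (simp add: sum_subsets_split_block[where \<phi> = "\<lambda>i W. partial_derangements l i * _"] min_absorb2)
  also have "\<dots> = (\<Sum>t\<^sub>1 = 0..min k l. \<Sum>t\<^sub>2 = 0..l - t\<^sub>1.
      coeff_A ?q k l t\<^sub>1 t\<^sub>2 * (coeff_B ?q k l t\<^sub>1)\<^sup>2)"
    using fin by (simp add: coeff_A_eq n_subsets card_F sum_distrib_left mult_ac)
  finally show ?thesis .
qed

end

text \<open>The pairs of second and third rows that fit the first row \<open>\<rho>\<close>.\<close>

definition completions :: "('a \<Rightarrow> 'c) \<Rightarrow> 'a set \<Rightarrow> 'c set \<Rightarrow> (('a \<Rightarrow> 'c) \<times> ('a \<Rightarrow> 'c)) set" where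
  "completions \<rho> V C = {p \<in> avoiding \<rho> V C \<times> avoiding \<rho> V C. \<forall>v\<in>V. fst p v \<noteq> snd p v}"

text \<open>
  Group the pairs by their common restriction \<open>f\<close> to \<open>L\<close>. Within a group the two components are
  arbitrary extensions of \<open>f\<close>, so the group is a Cartesian square.
\<close>

lemma card_agreeing_pairs:
  assumes "finite V" "finite C" "L \<subseteq> V"
  shows "int (card {p \<in> avoiding \<rho> V C \<times> avoiding \<rho> V C. \<forall>v\<in>L. fst p v = snd p v}) =
    (\<Sum>f\<in>avoiding \<rho> L C. (int (card (avoiding \<rho> (V - L) (C - f ` L))))\<^sup>2)"
proof -
  let ?A = "avoiding \<rho> V C"
  let ?X = "{p \<in> ?A \<times> ?A. \<forall>v\<in>L. fst p v = snd p v}"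
  let ?E = "\<lambda>f. {h \<in> ?A. restrict h L = f}"
  have fin: "finite ?A" "finite (avoiding \<rho> L C)"
    using assms by (auto intro: finite_injections finite_subset)
  have fibre: "{p. p \<in> ?X \<and> restrict (fst p) L = f} = ?E f \<times> ?E f" for f
    by (auto simp: fun_eq_iff restrict_def)
  have "int (card ?X) = (\<Sum>p\<in>?X. 1)"
    by simp
  also have "\<dots> = (\<Sum>f\<in>avoiding \<rho> L C. \<Sum>p | p \<in> ?X \<and> restrict (fst p) L = f. 1)"
    using fin assms(3) by (intro sum.group[symmetric]) (auto intro: restrict_in_injections)
  also have "\<dots> = (\<Sum>f\<in>avoiding \<rho> L C. (int (card (?E f)))\<^sup>2)"
    by (simp only: fibre) (simp add: card_cartesian_product power2_eq_square)
  also have "\<dots> = (\<Sum>f\<in>avoiding \<rho> L C. (int (card (avoiding \<rho> (V - L) (C - f ` L))))\<^sup>2)"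
    using assms(3) by (intro sum.cong refl) (simp add: card_extensions)
  finally show ?thesis .
qed

lemma card_completions:
  assumes "finite V" "finite C" "inj_on \<rho> V" "\<rho> ` V \<subseteq> C"
  shows "int (card (completions \<rho> V C)) =
    (\<Sum>l = 0..card V. (-1) ^ l * int (card V choose l) *
      (\<Sum>t\<^sub>1 = 0..min (card V - l) l. \<Sum>t\<^sub>2 = 0..l - t\<^sub>1.
        coeff_A (card C) (card V - l) l t\<^sub>1 t\<^sub>2 * (coeff_B (card C) (card V - l) l t\<^sub>1)\<^sup>2))"
proof -
  let ?A = "avoiding \<rho> V C"
  let ?T = "\<lambda>l. \<Sum>t\<^sub>1 = 0..min (card V - l) l. \<Sum>t\<^sub>2 = 0..l - t\<^sub>1.
    coeff_A (card C) (card V - l) l t\<^sub>1 t\<^sub>2 * (coeff_B (card C) (card V - l) l t\<^sub>1)\<^sup>2"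
  have agree: "int (card {p \<in> ?A \<times> ?A. \<forall>v\<in>L. fst p v = snd p v}) = ?T (card L)"
    if "L \<in> Pow V" for L
  proof -
    have L: "L \<subseteq> V" "card (V - L) = card V - card L"
      using that assms(1) by (auto simp: card_Diff_subset finite_subset)
    show ?thesis
      unfolding card_agreeing_pairs[OF assms(1,2) L(1)]
      by (rule sum_squared_extensions[OF assms L(1) refl L(2)])
  qed
  have "int (card (completions \<rho> V C)) = (\<Sum>L\<in>Pow V. (-1) ^ card L *
      int (card {p \<in> ?A \<times> ?A. \<forall>v\<in>L. fst p v = snd p v}))"
    unfolding completions_def using assms
    by (intro card_sieve[where P = "\<lambda>v p. fst p v = snd p v"]) (auto intro: finite_injections)
  also have "\<dots> = (\<Sum>L\<in>Pow V. (-1) ^ card L * ?T (card L))"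
    using agree by (intro sum.cong refl) simp
  also have "\<dots> = (\<Sum>l = 0..card V. int (card V choose l) * ((-1) ^ l * ?T l))"
    by (rule sum_Pow_by_card[OF assms(1)])
  finally show ?thesis
    by (simp only: mult_ac)
qed

section \<open>Colourings of the line graph as arrays with three rows\<close>

definition row :: "('a set \<Rightarrow> 'c) \<Rightarrow> 'a set \<Rightarrow> 'a \<Rightarrow> 'a \<Rightarrow> 'c" where
  "row c V u = (\<lambda>v\<in>V. c {u, v})"

context
  fixes K :: "('a, 'b) pre_digraph" and U V :: "'a set"
  assumes arcs: "arcs_ends K = U \<times> V \<union> V \<times> U" and disjoint: "U \<inter> V = {}"
begin

lemma undirected_edges_bipartite: "undirected_edges K = {{u, v} | u v. u \<in> U \<and> v \<in> V}"
  unfolding undirected_edges_def arcs by (auto simp: insert_commute)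

lemma edge_eq_iff:
  "u \<in> U \<Longrightarrow> u' \<in> U \<Longrightarrow> v \<in> V \<Longrightarrow> v' \<in> V \<Longrightarrow> {u, v} = {u', v'} \<longleftrightarrow> u = u' \<and> v = v'"
  using disjoint by (auto simp: doubleton_eq_iff)

lemma edge_meets_iff:
  "u \<in> U \<Longrightarrow> u' \<in> U \<Longrightarrow> v \<in> V \<Longrightarrow> v' \<in> V \<Longrightarrow> {u, v} \<inter> {u', v'} \<noteq> {} \<longleftrightarrow> u = u' \<or> v = v'"
  using disjoint by auto

text \<open>
  Distinct edges \<open>{u, v}\<close> and \<open>{u', v'}\<close> meet precisely when they lie in the same row or in the
  same column, so adjacency in the line graph separates into these two kinds of conditions.
\<close>

lemma proper_coloring_iff:
  "c \<in> proper_colorings (with_proj (line_graph K)) q \<longleftrightarrow>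
    c \<in> undirected_edges K \<rightarrow>\<^sub>E {1..q} \<and> (\<forall>u\<in>U. inj_on (row c V u) V) \<and>
    (\<forall>u\<in>U. \<forall>u'\<in>U. u \<noteq> u' \<longrightarrow> (\<forall>v\<in>V. row c V u v \<noteq> row c V u' v))"
proof -
  have "(\<forall>(e, f) \<in> parcs (line_graph K). c e \<noteq> c f) \<longleftrightarrow>
      (\<forall>u\<in>U. \<forall>v\<in>V. \<forall>u'\<in>U. \<forall>v'\<in>V.
        {u, v} \<noteq> {u', v'} \<and> {u, v} \<inter> {u', v'} \<noteq> {} \<longrightarrow> c {u, v} \<noteq> c {u', v'})"
    (is "?edges \<longleftrightarrow> ?ends")
  proof (intro iffI ballI impI)
    fix u v u' v'
    assume ?edges "u \<in> U" "v \<in> V" "u' \<in> U" "v' \<in> V"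
      and "{u, v} \<noteq> {u', v'} \<and> {u, v} \<inter> {u', v'} \<noteq> {}"
    moreover from this have "{u, v} \<in> undirected_edges K" "{u', v'} \<in> undirected_edges K"
      unfolding undirected_edges_bipartite by blast+
    ultimately have "({u, v}, {u', v'}) \<in> parcs (line_graph K)"
      by (auto simp: line_graph_def)
    then show "c {u, v} \<noteq> c {u', v'}"
      using \<open>?edges\<close> by blast
  next
    fix p
    assume ends: ?ends and "p \<in> parcs (line_graph K)"
    then obtain e f where p: "p = (e, f)" "e \<noteq> f \<and> e \<inter> f \<noteq> {}"
      and ef: "e \<in> undirected_edges K" "f \<in> undirected_edges K"
      by (auto simp: line_graph_def)
    obtain u v u' v' where "e = {u, v}" "f = {u', v'}" "u \<in> U" "v \<in> V" "u' \<in> U" "v' \<in> V"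
      using ef unfolding undirected_edges_bipartite by blast
    then show "case p of (e, f) \<Rightarrow> c e \<noteq> c f"
      using ends p by blast
  qed
  also have "\<dots> \<longleftrightarrow> (\<forall>u\<in>U. \<forall>v\<in>V. \<forall>u'\<in>U. \<forall>v'\<in>V.
      \<not> (u = u' \<and> v = v') \<and> (u = u' \<or> v = v') \<longrightarrow> c {u, v} \<noteq> c {u', v'})"
    by (intro ball_cong refl) (simp only: edge_eq_iff edge_meets_iff)
  also have "\<dots> \<longleftrightarrow> (\<forall>u\<in>U. inj_on (row c V u) V) \<and>
      (\<forall>u\<in>U. \<forall>u'\<in>U. u \<noteq> u' \<longrightarrow> (\<forall>v\<in>V. row c V u v \<noteq> row c V u' v))"
    by (auto simp: row_def inj_on_def)
  finally show ?thesis
    by (simp add: proper_colorings_def line_graph_def)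
qed

end

text \<open>
  The inverse recovers the colour of an edge from the row of its end among the \<open>u\<^sub>i\<close> and the column
  given by its unique end in \<open>V\<close>.
\<close>

lemma bij_betw_rows:
  fixes K :: "('a, 'b) pre_digraph"
  assumes arcs: "arcs_ends K = {u\<^sub>1, u\<^sub>2, u\<^sub>3} \<times> V \<union> V \<times> {u\<^sub>1, u\<^sub>2, u\<^sub>3}"
    and disjoint: "{u\<^sub>1, u\<^sub>2, u\<^sub>3} \<inter> V = {}"
    and distinct: "u\<^sub>1 \<noteq> u\<^sub>2" "u\<^sub>1 \<noteq> u\<^sub>3" "u\<^sub>2 \<noteq> u\<^sub>3"
  shows "bij_betw (\<lambda>c. (row c V u\<^sub>1, row c V u\<^sub>2, row c V u\<^sub>3))
    (proper_colorings (with_proj (line_graph K)) q)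
    (SIGMA \<rho> : injections (\<lambda>_ _. True) V {1..q}. completions \<rho> V {1..q})"
    (is "bij_betw ?rows ?P ?S")
proof -
  let ?E = "undirected_edges K"
  let ?glue = "\<lambda>(r\<^sub>1, r\<^sub>2, r\<^sub>3). \<lambda>e\<in>?E. (let v = the_elem (e \<inter> V) in
    if u\<^sub>1 \<in> e then r\<^sub>1 v else if u\<^sub>2 \<in> e then r\<^sub>2 v else r\<^sub>3 v)"
  note edges = undirected_edges_bipartite[OF arcs disjoint]
  note proper = proper_coloring_iff[OF arcs disjoint]
  have edge_Int: "{u, v} \<inter> V = {v}" if "u \<in> {u\<^sub>1, u\<^sub>2, u\<^sub>3}" "v \<in> V" for u v
    using that disjoint by auto
  have rows_glue: "row (?glue (r\<^sub>1, r\<^sub>2, r\<^sub>3)) V u\<^sub>1 = r\<^sub>1 \<and> row (?glue (r\<^sub>1, r\<^sub>2, r\<^sub>3)) V u\<^sub>2 = r\<^sub>2 \<and>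
      row (?glue (r\<^sub>1, r\<^sub>2, r\<^sub>3)) V u\<^sub>3 = r\<^sub>3"
    if "r\<^sub>1 \<in> extensional V" "r\<^sub>2 \<in> extensional V" "r\<^sub>3 \<in> extensional V" for r\<^sub>1 r\<^sub>2 r\<^sub>3 :: "'a \<Rightarrow> nat"
  proof -
    have "{u, v} \<in> ?E" if "u \<in> {u\<^sub>1, u\<^sub>2, u\<^sub>3}" "v \<in> V" for u v
      using that unfolding edges by blast
    then show ?thesis
      using that distinct disjoint edge_Int
      by (auto simp: row_def fun_eq_iff extensional_def)
  qed
  show ?thesis
  proof (rule bij_betwI[of _ _ _ ?glue])
    show "?rows \<in> ?P \<rightarrow> ?S"
    proof
      fix c assume c: "c \<in> ?P"
      have "row c V u \<in> V \<rightarrow>\<^sub>E {1..q}" if "u \<in> {u\<^sub>1, u\<^sub>2, u\<^sub>3}" for u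
        using c that unfolding proper edges row_def by (auto simp: PiE_iff)
      then show "?rows c \<in> ?S"
        using c distinct unfolding proper injections_def completions_def by auto
    qed
    show "?glue \<in> ?S \<rightarrow> ?P"
    proof
      fix p assume "p \<in> ?S"
      then obtain r\<^sub>1 r\<^sub>2 r\<^sub>3 where p: "p = (r\<^sub>1, r\<^sub>2, r\<^sub>3)"
        and r\<^sub>1: "r\<^sub>1 \<in> injections (\<lambda>_ _. True) V {1..q}"
        and r\<^sub>2\<^sub>3: "(r\<^sub>2, r\<^sub>3) \<in> completions r\<^sub>1 V {1..q}"
        by auto
      have r: "r\<^sub>1 \<in> V \<rightarrow>\<^sub>E {1..q}" "r\<^sub>2 \<in> V \<rightarrow>\<^sub>E {1..q}" "r\<^sub>3 \<in> V \<rightarrow>\<^sub>E {1..q}"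
        using r\<^sub>1 r\<^sub>2\<^sub>3 by (auto simp: injections_def completions_def)
      have "?glue p \<in> ?E \<rightarrow>\<^sub>E {1..q}"
      proof
        fix e assume e: "e \<in> ?E"
        then obtain v where "e \<inter> V = {v}" "v \<in> V"
          unfolding edges using edge_Int by blast
        then show "?glue p e \<in> {1..q}"
          using e r by (auto simp: p PiE_iff Let_def simp del: atLeastAtMost_iff)
      qed (auto simp: p)
      moreover have "row (?glue p) V u\<^sub>1 = r\<^sub>1" "row (?glue p) V u\<^sub>2 = r\<^sub>2" "row (?glue p) V u\<^sub>3 = r\<^sub>3"
        using rows_glue r unfolding p PiE_def by blast+
      ultimately show "?glue p \<in> ?P"
        using r\<^sub>1 r\<^sub>2\<^sub>3 distinct unfolding proper
        by (auto simp: injections_def completions_def dest: not_sym)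
    qed
    show "?glue (?rows c) = c" if "c \<in> ?P" for c
    proof
      fix e
      show "?glue (?rows c) e = c e"
      proof (cases "e \<in> ?E")
        case True
        then obtain u v where uv: "e = {u, v}" "u \<in> {u\<^sub>1, u\<^sub>2, u\<^sub>3}" "v \<in> V"
          unfolding edges by blast
        then show ?thesis
          using True edge_Int[OF uv(2,3)] disjoint by (auto simp: row_def)
      next
        case False
        then show ?thesis
          using that unfolding proper by (auto simp: PiE_iff extensional_def)
      qed
    qed
    show "?rows (?glue p) = p" if "p \<in> ?S" for p
      using that rows_glue by (auto simp: injections_def completions_def PiE_iff)
  qed
qed

theorem theorem3:
  fixes K :: "('a, 'b) pre_digraph" and n q :: nat
  assumes "1 \<le> n" and "n \<le> q"
    and "complete_bipartite_digraph 3 n K"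
  shows "real (chromatic_polynomial (with_proj (line_graph K)) q) =
    fact q / fact (q - n) *
    (\<Sum>l = 0..n. (-1) ^ l * real (n choose l) *
      (let k = n - l; b = min k l in
        \<Sum>t\<^sub>1 = 0..b. \<Sum>t\<^sub>2 = 0..l - t\<^sub>1.
          real_of_int (coeff_A q k l t\<^sub>1 t\<^sub>2) * (real_of_int (coeff_B q k l t\<^sub>1))\<^sup>2))"
proof -
  obtain U V where UV: "U \<inter> V = {}" "card U = 3" "card V = n" "arcs_ends K = U \<times> V \<union> V \<times> U"
    using assms(3) unfolding complete_bipartite_digraph_def by blast
  obtain u\<^sub>1 u\<^sub>2 u\<^sub>3 where U: "U = {u\<^sub>1, u\<^sub>2, u\<^sub>3}" "u\<^sub>1 \<noteq> u\<^sub>2" "u\<^sub>1 \<noteq> u\<^sub>3" "u\<^sub>2 \<noteq> u\<^sub>3"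
    using UV(2) by (auto simp: card_3_iff)
  have fin: "finite V"
    using UV(3) assms(1) by (intro card_ge_0_finite) simp
  let ?I = "injections (\<lambda>_ _. True) V {1..q}"
  \<comment> \<open>the number of ways to complete any given first row\<close>
  define N where "N = (\<Sum>l = 0..n. (-1) ^ l * int (n choose l) *
    (\<Sum>t\<^sub>1 = 0..min (n - l) l. \<Sum>t\<^sub>2 = 0..l - t\<^sub>1.
      coeff_A q (n - l) l t\<^sub>1 t\<^sub>2 * (coeff_B q (n - l) l t\<^sub>1)\<^sup>2))"
  have completions: "int (card (completions \<rho> V {1..q})) = N" if "\<rho> \<in> ?I" for \<rho>
    using card_completions[of V "{1..q}" \<rho>] that fin UV(3)
    by (auto simp: injections_def N_def)
  have "chromatic_polynomial (with_proj (line_graph K)) q =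
      card (SIGMA \<rho> : ?I. completions \<rho> V {1..q})"
    unfolding chromatic_polynomial_def
    using bij_betw_rows[of K u\<^sub>1 u\<^sub>2 u\<^sub>3 V q] UV U by (intro bij_betw_same_card) auto
  also have "\<dots> = (\<Sum>\<rho>\<in>?I. card (completions \<rho> V {1..q}))"
    using fin by (intro card_SigmaI) (auto simp: completions_def finite_injections)
  finally have "int (chromatic_polynomial (with_proj (line_graph K)) q) = int (card ?I) * N"
    using completions by simp
  then have "real (chromatic_polynomial (with_proj (line_graph K)) q) = real (card ?I) * real_of_int N"
    by (metis of_int_mult of_int_of_nat_eq)
  moreover have "real (card ?I) * fact (q - n) = fact q"
    using arg_cong[OF card_injections_unconstrained[of V "{1..q}"], of real] fin UV(3) assms(2)
    by simp
  then have "real (card ?I) = fact q / fact (q - n)"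
    by (simp add: field_simps)
  moreover have "real_of_int N = (\<Sum>l = 0..n. (-1) ^ l * real (n choose l) *
      (let k = n - l; b = min k l in
        \<Sum>t\<^sub>1 = 0..b. \<Sum>t\<^sub>2 = 0..l - t\<^sub>1.
          real_of_int (coeff_A q k l t\<^sub>1 t\<^sub>2) * (real_of_int (coeff_B q k l t\<^sub>1))\<^sup>2))"
    by (simp add: N_def Let_def)
  ultimately show ?thesis
    by simp
qed

end
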